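(* Let $n\ge 2$, let $F=F_n$ be the free group on generators $g_1,\dots,g_n$, let $F^{(1)}=[F,F]$ be its derived subgroup and $F^{(2)}=[F^{(1)},F^{(1)}]$. Let $K$ be an algebraically closed field of characteristic $0$. If $w\in F^{(1)}\setminus F^{(2)}$, then the word map $w:\mathrm{PSL}(2,K)^n\to \mathrm{PSL}(2,K)$ is surjective.
   Context: For a group $H$ and a reduced word $w=\prod_{i=1}^k g_{n_i}^{m_i}\in F_n$, the word map $w:H^n\to H$ is $(x_1,\dots,x_n)\mapsto \prod_{i=1}^k x_{n_i}^{m_i}$ (noncommutative product in the given order). *)

theory Defs
  imports "HOL-Analysis.Analysis" "HOL-Algebra.Algebra" "HOL-Computational_Algebra.Polynomial"
begin

section \<open>Free group F_n on generators g_0, ..., g_(n-1)\<close>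

text \<open>A letter (i, False) stands for the generator g_i, and (i, True) for its inverse.
  Elements of the free group are reduced words.\<close>

type_synonym letter = "nat \<times> bool"

definition inverse_letters :: "letter \<Rightarrow> letter \<Rightarrow> bool" where
  "inverse_letters x y \<longleftrightarrow> fst x = fst y \<and> snd x \<noteq> snd y"

definition reduced_word :: "letter list \<Rightarrow> bool" where
  "reduced_word w \<longleftrightarrow> (\<forall>i. Suc i < length w \<longrightarrow> \<not> inverse_letters (w ! i) (w ! Suc i))"

fun reduce :: "letter list \<Rightarrow> letter list" where
  "reduce [] = []"
| "reduce (x # xs) =
     (case reduce xs of
        [] \<Rightarrow> [x]
      | y # ys \<Rightarrow> (if inverse_letters x y then ys else x # y # ys))"

definition free_group :: "nat \<Rightarrow> letter list monoid" where
  "free_group n = \<lparr>carrier = {w. set w \<subseteq> {..<n} \<times> UNIV \<and> reduced_word w},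
                   mult = (\<lambda>u v. reduce (u @ v)),
                   one = []\<rparr>"

section \<open>Word maps\<close>

text \<open>The word map of the word w on a group G; a tuple (x_0,...,x_(n-1)) is a function
  nat => element, whose values at indices < n are relevant.\<close>

definition word_map :: "('a, 'b) monoid_scheme \<Rightarrow> letter list \<Rightarrow> (nat \<Rightarrow> 'a) \<Rightarrow> 'a" where
  "word_map G w xs =
     foldr (\<lambda>(i, b) acc. (if b then inv\<^bsub>G\<^esub> (xs i) else xs i) \<otimes>\<^bsub>G\<^esub> acc) w \<one>\<^bsub>G\<^esub>"

definition word_map_surjective :: "('a, 'b) monoid_scheme \<Rightarrow> nat \<Rightarrow> letter list \<Rightarrow> bool" where
  "word_map_surjective G n w \<longleftrightarrow>
     (\<forall>y \<in> carrier G. \<exists>xs. (\<forall>i<n. xs i \<in> carrier G) \<and> word_map G w xs = y)"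

section \<open>SL(2,K) and PSL(2,K)\<close>

definition SL2 :: "('k::field ^ 2 ^ 2) monoid" where
  "SL2 = \<lparr>carrier = {A. det A = 1}, mult = (**), one = mat 1\<rparr>"

definition PSL2 :: "('k::field ^ 2 ^ 2) set monoid" where
  "PSL2 = SL2 Mod {mat 1, - mat 1}"

end

theory Submission
  imports Defs
begin

text \<open>
  Two matrices of SL(2,K) that are not scalar and have the same trace are conjugate, so it suffices
  to find values of the word map that are not scalar and have a prescribed trace other than \<open>-2\<close>;
  sign changes in PSL(2,K) take care of the trace \<open>-2\<close>.

  Trace 2. The derived subgroup \<open>F\<^sup>(\<^sup>1\<^sup>)\<close> is the fundamental group of the Cayley graph of the
  abelianization of \<open>F\<close>. Since \<open>w \<notin> F\<^sup>(\<^sup>2\<^sup>)\<close>, the loop spelled by \<open>w\<close> has a nonzero 1-chain.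
  On upper triangular matrices the off-diagonal entry of \<open>w\<close> is this chain evaluated at characters,
  so \<open>w\<close> takes a nontrivial unipotent value \<open>u\<close>.

  Other traces. SL(2,K) is the image of an affine space, so on a suitable curve through the trivial
  tuple the trace of \<open>w\<close> is a polynomial in one variable; it takes every value of K unless the trace
  of \<open>w\<close> is constantly 2. In that case \<open>w\<close> is trivial on integral quaternions, because their
  norm form is anisotropic, and hence on all matrices by Zariski density, contradicting \<open>u \<noteq> 1\<close>.
\<close>

section \<open>Signed products over any index type: generators of a group, or edges of a
  graph\<close>

definition signed_prod :: "('a, 'm) monoid_scheme \<Rightarrow> ('k \<Rightarrow> 'a) \<Rightarrow> ('k \<times> bool) list \<Rightarrow> 'a" where
  "signed_prod G E l =
     foldr (\<lambda>(k, b) acc. (if b then inv\<^bsub>G\<^esub> (E k) else E k) \<otimes>\<^bsub>G\<^esub> acc) l \<one>\<^bsub>G\<^esub>"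

lemma word_map_eq_signed_prod: "word_map G w xs = signed_prod G xs w"
  by (simp add: word_map_def signed_prod_def)

lemma signed_prod_Nil [simp]: "signed_prod G E [] = \<one>\<^bsub>G\<^esub>"
  by (simp add: signed_prod_def)

lemma signed_prod_Cons [simp]:
  "signed_prod G E ((k, b) # l) = (if b then inv\<^bsub>G\<^esub> (E k) else E k) \<otimes>\<^bsub>G\<^esub> signed_prod G E l"
  by (simp add: signed_prod_def)

context group
begin

lemma signed_prod_in_subgroup:
  assumes "subgroup H G" "\<And>k b. (k, b) \<in> set l \<Longrightarrow> E k \<in> H"
  shows "signed_prod G E l \<in> H"
  using assms(2)
proof (induction l)
  case Nil
  then show ?case using assms(1) by (simp add: subgroup.one_closed)
next
  case (Cons x l)
  obtain k b where x: "x = (k, b)" by (cases x)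
  have "E k \<in> H" using Cons.prems[of k b] x by simp
  moreover have "signed_prod G E l \<in> H" using Cons.IH Cons.prems by (meson list.set_intros(2))
  ultimately show ?case
    using assms(1) x by (auto intro: subgroup.m_closed subgroup.m_inv_closed)
qed

lemma signed_prod_append:
  assumes "\<And>k b. (k, b) \<in> set (l @ l') \<Longrightarrow> E k \<in> carrier G"
  shows "signed_prod G E (l @ l') = signed_prod G E l \<otimes> signed_prod G E l'"
  using assms
proof (induction l)
  case Nil
  then show ?case
    by (simp add: signed_prod_in_subgroup[OF subgroup_self])
next
  case (Cons x l)
  obtain k b where x: "x = (k, b)" by (cases x)
  have "E k \<in> carrier G" using Cons.prems[of k b] x by simp
  moreover have "signed_prod G E l \<in> carrier G" "signed_prod G E l' \<in> carrier G"
    using Cons.prems by (auto intro!: signed_prod_in_subgroup[OF subgroup_self])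
  moreover have "signed_prod G E (l @ l') = signed_prod G E l \<otimes> signed_prod G E l'"
    by (rule Cons.IH) (use Cons.prems in auto)
  ultimately show ?case
    using x by (simp add: m_assoc)
qed

text \<open>The letter \<open>k\<close> at the head cancels, up to a commutator, against a letter of opposite sign.\<close>

lemma signed_prod_balanced_in_derived:
  assumes H: "subgroup H G"
    and EH: "\<And>k b. (k, b) \<in> set l \<Longrightarrow> E k \<in> H"
    and bal: "\<And>k. count_list l (k, True) = count_list l (k, False)"
  shows "signed_prod G E l \<in> derived G H"
  using EH bal
proof (induction l rule: length_induct)
  case (1 l)
  have HG: "H \<subseteq> carrier G" using H by (rule subgroup.subset)
  have D: "subgroup (derived G H) G" by (rule derived_is_subgroup[OF HG])
  show ?case
  proof (cases l)
    case Nil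
    then show ?thesis using D by (simp add: subgroup.one_closed)
  next
    case (Cons x l0)
    obtain k b where x: "x = (k, b)" by (cases x)
    have "count_list l (k, \<not> b) = count_list l (k, b)"
      using "1.prems"(2)[of k] by (cases b) auto
    hence "count_list l0 (k, \<not> b) > 0" using Cons x by auto
    hence "(k, \<not> b) \<in> set l0" by (metis count_list_0_iff less_irrefl)
    then obtain l1 l2 where l0: "l0 = l1 @ (k, \<not> b) # l2"
      by (meson split_list)
    have l: "l = (k, b) # l1 @ (k, \<not> b) # l2" using Cons x l0 by simp
    define z where "z = (if b then inv (E k) else E k)"
    have Ek: "E k \<in> H" using "1.prems"(1)[of k b] l by simp
    have XH: "z \<in> H" using Ek H by (simp add: z_def subgroup.m_inv_closed)
    have EH': "E k' \<in> H" if "(k', b') \<in> set (l1 @ l2)" for k' b'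
      using "1.prems"(1)[of k' b'] that l by auto
    have P1: "signed_prod G E l1 \<in> H" and P2: "signed_prod G E l2 \<in> H"
      using EH' by (auto intro!: signed_prod_in_subgroup[OF H])
    have IH: "signed_prod G E (l1 @ l2) \<in> derived G H"
    proof -
      have "count_list (l1 @ l2) (k', True) = count_list (l1 @ l2) (k', False)" for k'
        using "1.prems"(2)[of k'] l by (cases b) (auto split: if_splits)
      moreover have "length (l1 @ l2) < length l" using l by simp
      ultimately show ?thesis using "1.IH" EH' by blast
    qed
    have sp12: "signed_prod G E (l1 @ l2) = signed_prod G E l1 \<otimes> signed_prod G E l2"
      using EH' HG by (intro signed_prod_append) blast
    have "(if \<not> b then inv (E k) else E k) = inv z"
      using Ek HG by (auto simp: z_def)
    moreover have "signed_prod G E (l1 @ (k, \<not> b) # l2)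
        = signed_prod G E l1 \<otimes> signed_prod G E ((k, \<not> b) # l2)"
      using EH' HG Ek by (intro signed_prod_append) auto
    ultimately have "signed_prod G E l
        = z \<otimes> (signed_prod G E l1 \<otimes> (inv z \<otimes> signed_prod G E l2))"
      by (simp only: l signed_prod_Cons z_def)
    also have "\<dots> = (z \<otimes> signed_prod G E l1 \<otimes> inv z \<otimes> inv (signed_prod G E l1))
        \<otimes> signed_prod G E (l1 @ l2)"
    proof -
      have c: "z \<in> carrier G" "signed_prod G E l1 \<in> carrier G" "signed_prod G E l2 \<in> carrier G"
        using XH P1 P2 HG by auto
      have "inv (signed_prod G E l1) \<otimes> (signed_prod G E l1 \<otimes> signed_prod G E l2) = signed_prod G E l2"
        using c by (simp add: m_assoc[symmetric])
      then show ?thesis using c by (simp add: sp12 m_assoc)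
    qed
    also have "\<dots> \<in> derived G H"
    proof -
      have "z \<otimes> signed_prod G E l1 \<otimes> inv z \<otimes> inv (signed_prod G E l1) \<in> derived G H"
        unfolding derived_def by (rule generate.incl) (use XH P1 in blast)
      then show ?thesis using IH D by (simp add: subgroup.m_closed)
    qed
    finally show ?thesis .
  qed
qed

end

section \<open>The free group\<close>

text \<open>One step of \<open>reduce\<close>. Letting letters act on reduced words by
  \<open>push_letter\<close> is van der Waerden's way to associativity in the free group: inverse
  letters act inversely.\<close>

definition push_letter :: "letter \<Rightarrow> letter list \<Rightarrow> letter list" where
  "push_letter x w = (case w of [] \<Rightarrow> [x] | y # ys \<Rightarrow> if inverse_letters x y then ys else x # y # ys)"

lemma reduce_eq_foldr: "reduce w = foldr push_letter w []"
  by (induction w) (auto simp: push_letter_def)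

lemma reduced_word_Nil [simp]: "reduced_word []"
  by (simp add: reduced_word_def)

lemma reduced_word_Cons:
  "reduced_word (x # w) \<longleftrightarrow> reduced_word w \<and> (w \<noteq> [] \<longrightarrow> \<not> inverse_letters x (hd w))"
proof (cases w)
  case (Cons y ys)
  have "(\<forall>i. Suc i < length (x # w) \<longrightarrow> \<not> inverse_letters ((x # w) ! i) ((x # w) ! Suc i))
    \<longleftrightarrow> \<not> inverse_letters x y \<and>
      (\<forall>i. Suc i < length w \<longrightarrow> \<not> inverse_letters (w ! i) (w ! Suc i))" (is "?A \<longleftrightarrow> ?B \<and> ?C")
  proof (intro iffI conjI)
    assume A: ?A
    show ?B using A[rule_format, of 0] Cons by simp
    show ?C using A by (metis Suc_less_eq length_Cons nth_Cons_Suc)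
  next
    assume BC: "?B \<and> ?C"
    show ?A
    proof (intro allI impI)
      fix i assume "Suc i < length (x # w)"
      then show "\<not> inverse_letters ((x # w) ! i) ((x # w) ! Suc i)"
        using BC Cons by (cases i) auto
    qed
  qed
  then show ?thesis using Cons by (auto simp: reduced_word_def)
qed (simp add: reduced_word_def)

lemma reduced_push_letter: "reduced_word w \<Longrightarrow> reduced_word (push_letter x w)"
  by (cases w) (auto simp: push_letter_def reduced_word_Cons)

lemma reduced_foldr_push: "reduced_word z \<Longrightarrow> reduced_word (foldr push_letter u z)"
  by (induction u) (auto simp: reduced_push_letter)

lemma reduced_reduce: "reduced_word (reduce w)"
  by (simp add: reduce_eq_foldr reduced_foldr_push)

lemma reduce_reduced: "reduced_word w \<Longrightarrow> reduce w = w"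
  by (induction w) (auto simp: reduced_word_Cons split: list.splits)

text \<open>If \<open>y\<close> cancels the head of \<open>z\<close>, that head is \<open>x\<close>,
  and because \<open>z\<close> is reduced, \<open>x\<close> pushed back onto the tail meets no
  inverse letter.\<close>

lemma push_letter_cancel:
  assumes "inverse_letters x y" "reduced_word z"
  shows "push_letter x (push_letter y z) = z"
proof (cases z)
  case Nil
  then show ?thesis using assms by (simp add: push_letter_def)
next
  case (Cons a as)
  show ?thesis
  proof (cases "inverse_letters y a")
    case True
    hence "x = a" using assms(1) by (auto simp: inverse_letters_def prod_eq_iff)
    then show ?thesis using assms(2) Cons True
      by (cases as) (auto simp: push_letter_def reduced_word_Cons)
  next
    case False
    then show ?thesis using assms Cons by (simp add: push_letter_def)
  qed
qed

lemma foldr_push_push: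
  assumes "reduced_word z"
  shows "foldr push_letter (push_letter x u) z = push_letter x (foldr push_letter u z)"
proof (cases u)
  case (Cons y ys)
  have "reduced_word (foldr push_letter ys z)" using assms by (rule reduced_foldr_push)
  then show ?thesis using Cons push_letter_cancel by (auto simp: push_letter_def[of x "y # ys"])
qed (simp add: push_letter_def)

text \<open>Words act through their reductions; this makes a product independent of when its factors
  are reduced.\<close>

lemma foldr_push_reduce:
  assumes "reduced_word z"
  shows "foldr push_letter (reduce u) z = foldr push_letter u z"
  by (induction u) (simp_all add: reduce_eq_foldr foldr_push_push[OF assms])

lemma reduce_append: "reduce (u @ v) = foldr push_letter u (reduce v)"
  by (simp add: reduce_eq_foldr)

lemma reduce_append_reduce_left: "reduce (reduce u @ v) = reduce (u @ v)"
  by (simp add: reduce_append foldr_push_reduce reduced_reduce)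

lemma reduce_append_reduce_right: "reduce (u @ reduce v) = reduce (u @ v)"
  by (simp add: reduce_append reduce_reduced reduced_reduce)

lemma set_push_letter: "set (push_letter x w) \<subseteq> insert x (set w)"
  by (auto simp: push_letter_def split: list.splits if_splits)

lemma set_reduce: "set (reduce w) \<subseteq> set w"
proof (induction w)
  case (Cons x w)
  then show ?case using set_push_letter[of x "reduce w"]
    by (auto simp: reduce_eq_foldr)
qed simp

lemma in_carrier_free_group:
  "w \<in> carrier (free_group n) \<longleftrightarrow> set w \<subseteq> {..<n} \<times> UNIV \<and> reduced_word w"
  by (simp add: free_group_def)

lemma mult_free_group [simp]: "u \<otimes>\<^bsub>free_group n\<^esub> v = reduce (u @ v)"
  by (simp add: free_group_def)

lemma one_free_group [simp]: "\<one>\<^bsub>free_group n\<^esub> = []"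
  by (simp add: free_group_def)

definition flip_letter :: "letter \<Rightarrow> letter" where
  "flip_letter x = (fst x, \<not> snd x)"

lemma reduce_flip_append: "reduce (rev (map flip_letter w) @ w) = []"
proof (induction w)
  case (Cons x w)
  have "inverse_letters (flip_letter x) x" by (simp add: inverse_letters_def flip_letter_def)
  hence "push_letter (flip_letter x) (push_letter x (reduce w)) = reduce w"
    by (rule push_letter_cancel) (rule reduced_reduce)
  hence "reduce (flip_letter x # x # w) = reduce w"
    by (simp only: reduce_eq_foldr foldr.simps o_apply)
  hence "reduce (rev (map flip_letter w) @ flip_letter x # x # w) = reduce (rev (map flip_letter w) @ w)"
    by (metis reduce_append_reduce_right)
  then show ?case using Cons by simp
qed simp

lemma group_free_group: "group (free_group n)"
proof (rule groupI)
  fix x y z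
  assume x: "x \<in> carrier (free_group n)"
  show "\<one>\<^bsub>free_group n\<^esub> \<otimes>\<^bsub>free_group n\<^esub> x = x"
    using x by (simp add: in_carrier_free_group reduce_reduced)
  let ?i = "reduce (rev (map flip_letter x))"
  have "?i \<in> carrier (free_group n)"
    using x set_reduce[of "rev (map flip_letter x)"]
    by (fastforce simp: in_carrier_free_group reduced_reduce flip_letter_def)
  moreover have "?i \<otimes>\<^bsub>free_group n\<^esub> x = \<one>\<^bsub>free_group n\<^esub>"
    by (simp add: reduce_append_reduce_left reduce_flip_append)
  ultimately show "\<exists>y\<in>carrier (free_group n). y \<otimes>\<^bsub>free_group n\<^esub> x = \<one>\<^bsub>free_group n\<^esub>" by blast
  assume y: "y \<in> carrier (free_group n)"
  show "x \<otimes>\<^bsub>free_group n\<^esub> y \<in> carrier (free_group n)"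
    using x y set_reduce[of "x @ y"] by (auto simp: in_carrier_free_group reduced_reduce)
  assume z: "z \<in> carrier (free_group n)"
  show "x \<otimes>\<^bsub>free_group n\<^esub> y \<otimes>\<^bsub>free_group n\<^esub> z = x \<otimes>\<^bsub>free_group n\<^esub> (y \<otimes>\<^bsub>free_group n\<^esub> z)"
    by (simp add: reduce_append_reduce_left reduce_append_reduce_right)
qed (simp add: in_carrier_free_group)

abbreviation generator :: "nat \<Rightarrow> letter list" where
  "generator i \<equiv> [(i, False)]"

lemma generator_in_carrier: "i < n \<Longrightarrow> generator i \<in> carrier (free_group n)"
  by (simp add: in_carrier_free_group reduced_word_def)

lemma inv_generator: "i < n \<Longrightarrow> inv\<^bsub>free_group n\<^esub> (generator i) = [(i, True)]"
  by (rule group.inv_equality[OF group_free_group])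
    (auto simp: in_carrier_free_group reduced_word_def inverse_letters_def)

lemma signed_prod_generators:
  assumes "set w \<subseteq> {..<n} \<times> UNIV"
  shows "signed_prod (free_group n) generator w = reduce w"
  using assms
proof (induction w)
  case (Cons x w)
  obtain i b where x: "x = (i, b)" by (cases x)
  have "i < n" using Cons x by auto
  hence "signed_prod (free_group n) generator (x # w) = reduce ([x] @ reduce w)"
    using Cons x by (cases b) (simp_all add: inv_generator)
  also have "\<dots> = reduce (x # w)" by (simp only: reduce_append_reduce_right) simp
  finally show ?case .
qed simp

section \<open>The abelianization of the free group\<close>

definition letter_class :: "letter \<Rightarrow> int poly" where
  "letter_class x = (if snd x then - Polynomial.monom 1 (fst x) else Polynomial.monom 1 (fst x))"

text \<open>The abelianization of the free group, with \<^term>\<open>Polynomial.monom 1 i\<close> as the class of the i-th generator.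
  Integer polynomials are convenient because evaluating them at a suitable integer separates
  any finitely many classes.\<close>

definition word_class :: "letter list \<Rightarrow> int poly" where
  "word_class w = (\<Sum>x\<leftarrow>w. letter_class x)"

lemma word_class_simps [simp]:
  "word_class [] = 0" "word_class (x # w) = letter_class x + word_class w"
  "word_class (u @ v) = word_class u + word_class v"
  by (simp_all add: word_class_def)

lemma word_class_push_letter: "word_class (push_letter x w) = letter_class x + word_class w"
  by (cases w) (auto simp: push_letter_def inverse_letters_def letter_class_def)

lemma word_class_reduce [simp]: "word_class (reduce w) = word_class w"
  by (induction w) (simp_all add: reduce_eq_foldr word_class_push_letter)

lemma coeff_word_class:
  "Polynomial.coeff (word_class w) i = int (count_list w (i, False)) - int (count_list w (i, True))"
  by (induction w) (auto simp: letter_class_def)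

lemma word_class_inv:
  assumes "u \<in> carrier (free_group n)"
  shows "word_class (inv\<^bsub>free_group n\<^esub> u) = - word_class u"
proof -
  have "inv\<^bsub>free_group n\<^esub> u \<otimes>\<^bsub>free_group n\<^esub> u = \<one>\<^bsub>free_group n\<^esub>"
    using assms by (rule group.l_inv[OF group_free_group])
  hence "word_class (reduce (inv\<^bsub>free_group n\<^esub> u @ u)) = 0" by simp
  hence "word_class (inv\<^bsub>free_group n\<^esub> u) + word_class u = 0" by simp
  then show ?thesis by (rule eq_neg_iff_add_eq_0[THEN iffD2])
qed

lemma word_class_derived:
  assumes "w \<in> derived (free_group n) (carrier (free_group n))"
  shows "word_class w = 0"
proof -
  interpret F: group "free_group n" by (rule group_free_group)
  let ?D = "derived_set (free_group n) (carrier (free_group n))"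
  have D: "word_class h = 0 \<and> h \<in> carrier (free_group n)" if "h \<in> ?D" for h
  proof -
    from that obtain x y where xy: "x \<in> carrier (free_group n)" "y \<in> carrier (free_group n)"
      and h: "h = x \<otimes>\<^bsub>free_group n\<^esub> y \<otimes>\<^bsub>free_group n\<^esub> inv\<^bsub>free_group n\<^esub> x \<otimes>\<^bsub>free_group n\<^esub> inv\<^bsub>free_group n\<^esub> y"
      by blast
    have "h \<in> carrier (free_group n)" unfolding h using xy by (intro F.m_closed F.inv_closed)
    moreover have "word_class h = 0" unfolding h using xy by (simp add: word_class_inv)
    ultimately show ?thesis by simp
  qed
  from assms show ?thesis unfolding derived_def
  proof (induction rule: generate.induct)
    case one
    show ?case by simp
  next
    case (incl h)
    show ?case using D[OF incl] by (rule conjunct1)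
  next
    case (inv h)
    show ?case using D[OF inv] by (metis word_class_inv neg_0_equal_iff_equal)
  next
    case (eng h1 h2)
    then show ?case by simp
  qed
qed

text \<open>A coefficient of \<open>word_class w\<close> is the exponent sum of one generator, so
  class 0 means that letters and inverse letters balance, and
  \<open>signed_prod_balanced_in_derived\<close> applies.\<close>

lemma derived_if_word_class_0:
  assumes "w \<in> carrier (free_group n)" "word_class w = 0"
  shows "w \<in> derived (free_group n) (carrier (free_group n))"
proof -
  interpret F: group "free_group n" by (rule group_free_group)
  have "count_list w (i, True) = count_list w (i, False)" for i
    using coeff_word_class[of w i] assms(2) by simp
  hence "signed_prod (free_group n) generator w \<in> derived (free_group n) (carrier (free_group n))"
    using assms(1) by (intro F.signed_prod_balanced_in_derived[OF F.subgroup_self] generator_in_carrier)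
      (auto simp: in_carrier_free_group)
  then show ?thesis using assms(1)
    by (simp add: signed_prod_generators in_carrier_free_group reduce_reduced)
qed

section \<open>Paths in the Cayley graph of the abelianization\<close>

text \<open>The edges of the Cayley graph of the abelianization traversed by the path that starts at
  \<open>v\<close> and spells a word; \<open>(v, i)\<close> is the edge from \<open>v\<close> to \<^term>\<open>v + Polynomial.monom 1 i\<close>, and the
  flag says whether it is traversed backwards.\<close>

fun path_edges :: "int poly \<Rightarrow> letter list \<Rightarrow> ((int poly \<times> nat) \<times> bool) list" where
  "path_edges v [] = []"
| "path_edges v ((i, b) # w) =
     ((if b then v - Polynomial.monom 1 i else v, i), b) # path_edges (v + letter_class (i, b)) w"

text \<open>Telescoping: the factor \<open>inv (s v')\<close> of one edge cancels against the
  \<open>s v'\<close> of the next. When \<open>s\<close> chooses coset representatives, the edge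
  elements are Schreier generators.\<close>

lemma (in group) signed_prod_path_edges:
  assumes s: "\<And>v. s v \<in> carrier G"
    and g: "\<And>i b. (i, b) \<in> set w \<Longrightarrow> g i \<in> carrier G"
  shows "signed_prod G (\<lambda>(v, i). s v \<otimes> g i \<otimes> inv (s (v + Polynomial.monom 1 i))) (path_edges v w)
    = s v \<otimes> signed_prod G g w \<otimes> inv (s (v + word_class w))"
  using g
proof (induction w arbitrary: v)
  case Nil
  then show ?case using s by simp
next
  case (Cons x w)
  obtain i b where x: "x = (i, b)" by (cases x)
  define v' where "v' = v + letter_class x"
  define h where "h = (if b then inv (g i) else g i)"
  define W where "W = signed_prod G g w"
  have gi: "g i \<in> carrier G" using Cons.prems[of i b] x by simp
  hence h: "h \<in> carrier G" by (simp add: h_def)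
  have W: "W \<in> carrier G" unfolding W_def
    using Cons.prems by (auto intro!: signed_prod_in_subgroup[OF subgroup_self])
  let ?E = "\<lambda>(v, i). s v \<otimes> g i \<otimes> inv (s (v + Polynomial.monom 1 i))"
  have IH: "signed_prod G ?E (path_edges v' w) = s v' \<otimes> W \<otimes> inv (s (v' + word_class w))"
    unfolding W_def using Cons.prems by (intro Cons.IH) auto
  have "signed_prod G ?E (path_edges v (x # w)) = (s v \<otimes> h \<otimes> inv (s v')) \<otimes> signed_prod G ?E (path_edges v' w)"
    using s gi by (cases b) (simp_all add: x v'_def h_def letter_class_def inv_mult_group m_assoc)
  also have "\<dots> = s v \<otimes> (h \<otimes> W) \<otimes> inv (s (v' + word_class w))"
  proof -
    have "inv (s v') \<otimes> (s v' \<otimes> (W \<otimes> inv (s (v' + word_class w)))) = W \<otimes> inv (s (v' + word_class w))"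
      using s W by (simp add: m_assoc[symmetric])
    then show ?thesis using s h W by (simp add: IH m_assoc)
  qed
  also have "\<dots> = s v \<otimes> signed_prod G g (x # w) \<otimes> inv (s (v + word_class (x # w)))"
    by (simp add: x h_def W_def v'_def add.assoc)
  finally show ?case .
qed

text \<open>This allows representatives to be chosen at both ends of each edge: the classes of words
  in \<open>n\<close> generators do not exhaust the integer polynomials.\<close>

lemma path_edges_in_classes:
  assumes "((u, i), b) \<in> set (path_edges v w)" "set w \<subseteq> {..<n} \<times> UNIV"
    "v \<in> word_class ` carrier (free_group n)"
  shows "i < n \<and> u \<in> word_class ` carrier (free_group n)
    \<and> u + Polynomial.monom 1 i \<in> word_class ` carrier (free_group n)"
  using assms
proof (induction w arbitrary: v)
  case (Cons x w)
  obtain j c where x: "x = (j, c)" by (cases x)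
  have j: "j < n" using Cons.prems x by auto
  obtain z where z: "z \<in> carrier (free_group n)" "v = word_class z" using Cons.prems(3) by blast
  have "reduce (z @ [x]) \<in> carrier (free_group n)"
    using z j x set_reduce[of "z @ [x]"] by (auto simp: in_carrier_free_group reduced_reduce)
  moreover have "v + letter_class x = word_class (reduce (z @ [x]))" using z by simp
  ultimately have v': "v + letter_class x \<in> word_class ` carrier (free_group n)" by blast
  show ?case
  proof (cases "((u, i), b) \<in> set (path_edges (v + letter_class x) w)")
    case True
    then show ?thesis using Cons.IH[OF True _ v'] Cons.prems(2) by simp
  next
    case False
    hence "u = (if c then v - Polynomial.monom 1 j else v)" "i = j"
      using Cons.prems(1) by (auto simp: x)
    then show ?thesis using j v' Cons.prems(3) by (auto simp: x letter_class_def)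
  qed
qed simp

text \<open>The derived subgroup is the fundamental group of the Cayley graph of the abelianization,
  so its own abelianization embeds into the 1-chains.\<close>

lemma second_derived_if_balanced:
  assumes w: "w \<in> derived (free_group n) (carrier (free_group n))"
    and bal: "\<And>e. count_list (path_edges 0 w) (e, True) = count_list (path_edges 0 w) (e, False)"
  shows "w \<in> derived (free_group n) (derived (free_group n) (carrier (free_group n)))"
proof -
  interpret F: group "free_group n" by (rule group_free_group)
  let ?C = "carrier (free_group n)"
  let ?m = "\<lambda>i. Polynomial.monom (1 :: int) i"
  have F': "subgroup (derived (free_group n) ?C) (free_group n)"
    by (rule F.derived_is_subgroup) simp
  have wC: "w \<in> ?C" using w F' subgroup.subset by blast
  hence wn: "set w \<subseteq> {..<n} \<times> UNIV" and wred: "reduced_word w"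
    by (auto simp: in_carrier_free_group)
  have nil: "[] \<in> ?C" by (simp add: in_carrier_free_group)
  \<comment> \<open>A transversal of the derived subgroup. The value \<open>[]\<close> at 0 makes
    both outer factors of the telescoped product trivial, as \<open>w\<close> spells a loop at 0;
    the value off the image keeps \<open>s\<close> in the carrier.\<close>
  define s where "s v = (if v = 0 \<or> v \<notin> word_class ` ?C then [] else SOME u. u \<in> ?C \<and> word_class u = v)" for v
  have ex: "(SOME u. u \<in> ?C \<and> word_class u = v) \<in> ?C \<and> word_class (SOME u. u \<in> ?C \<and> word_class u = v) = v"
    if "v \<in> word_class ` ?C" for v
    by (rule someI_ex) (use that in blast)
  have sC: "s v \<in> ?C" for v using ex[of v] nil by (auto simp: s_def)
  have sv: "word_class (s v) = v" if "v \<in> word_class ` ?C" for v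
    using ex[OF that] that by (auto simp: s_def)
  define E where "E = (\<lambda>(v, i). s v \<otimes>\<^bsub>free_group n\<^esub> generator i \<otimes>\<^bsub>free_group n\<^esub> inv\<^bsub>free_group n\<^esub> (s (v + ?m i)))"
  \<comment> \<open>Each Schreier generator has class \<open>v + ?m i - (v + ?m i)\<close>, which is
    0.\<close>
  have E: "E e \<in> derived (free_group n) ?C" if e: "(e, b) \<in> set (path_edges 0 w)" for e b
  proof -
    obtain v i where vi: "e = (v, i)" by (cases e)
    have 0: "0 \<in> word_class ` ?C" using nil by force
    have i: "i < n" and v: "v \<in> word_class ` ?C" "v + ?m i \<in> word_class ` ?C"
      using path_edges_in_classes[OF e[unfolded vi] wn 0] by auto
    have "E e \<in> ?C" unfolding E_def vi prod.case
      by (intro F.m_closed F.inv_closed sC generator_in_carrier i)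
    moreover have "word_class (E e) = 0"
      by (simp add: E_def vi word_class_inv sC sv v letter_class_def)
    ultimately show ?thesis by (rule derived_if_word_class_0)
  qed
  have "signed_prod (free_group n) E (path_edges 0 w)
    = s 0 \<otimes>\<^bsub>free_group n\<^esub> signed_prod (free_group n) generator w \<otimes>\<^bsub>free_group n\<^esub> inv\<^bsub>free_group n\<^esub> (s (0 + word_class w))"
    unfolding E_def using wn by (intro F.signed_prod_path_edges sC generator_in_carrier) auto
  also have "\<dots> = w"
  proof -
    have "s 0 = \<one>\<^bsub>free_group n\<^esub>" by (simp add: s_def)
    moreover have "signed_prod (free_group n) generator w = w"
      using wn wred by (simp add: signed_prod_generators reduce_reduced)
    ultimately show ?thesis using F.l_one[OF wC] F.r_one[OF wC] F.inv_one word_class_derived[OF w]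
      by (simp del: mult_free_group one_free_group)
  qed
  finally have "signed_prod (free_group n) E (path_edges 0 w) = w" .
  moreover have "signed_prod (free_group n) E (path_edges 0 w)
      \<in> derived (free_group n) (derived (free_group n) ?C)"
    by (rule F.signed_prod_balanced_in_derived[OF F']) (use E bal in auto)
  ultimately show ?thesis by simp
qed

text \<open>Evaluating vertices at \<open>M\<close> turns the edges of direction \<open>i0\<close>
  into a Laurent polynomial in \<open>t\<close>. If \<open>M\<close> separates \<open>v0\<close>
  from the other vertices, its coefficient at exponent \<open>poly v0 (int M)\<close> is the net
  number of passes through \<open>(v0, i0)\<close>, nonzero in characteristic 0; so some
  \<open>t\<close> is not a root.\<close>

lemma unbalanced_edges_nonzero_sum:
  fixes L :: "((int poly \<times> nat) \<times> bool) list"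
  assumes unbal: "count_list L ((v0, i0), True) \<noteq> count_list L ((v0, i0), False)"
  shows "\<exists>(M::nat) (t::'k::field_char_0). t \<noteq> 0 \<and>
    (\<Sum>((v, i), b)\<leftarrow>L. (if b then - 1 else 1) * (if i = i0 then t powi (poly v (int M)) else 0)) \<noteq> 0"
proof -
  define V where "V = insert v0 ((\<lambda>e. fst (fst e)) ` set L)"
  have V: "finite V" by (simp add: V_def)
  have VL: "v \<in> V" if "((v, i), b) \<in> set L" for v i b
    using that by (force simp: V_def)
  \<comment> \<open>A non-root of \<open>D\<close> is a point where no other vertex in
    \<open>V\<close> takes the value of \<open>v0\<close>.\<close>
  define D where "D = (\<Prod>v\<in>V - {v0}. v - v0)"
  have "D \<noteq> 0" using V by (simp add: D_def)
  hence "finite {x. poly D x = 0}" by (rule poly_roots_finite)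
  hence "finite {M. poly D (int M) = 0}"
    using finite_vimageI[of "{x. poly D x = 0}" int] by (simp add: vimage_def inj_on_def)
  then obtain M where M: "poly D (int M) \<noteq> 0"
    using infinite_UNIV_nat ex_new_if_finite[of "{M. poly D (int M) = 0}"] by auto
  define e where "e v = poly v (int M)" for v
  have e: "e v \<noteq> e v0" if "v \<in> V" "v \<noteq> v0" for v
    using M V that by (auto simp: D_def poly_prod e_def)
  \<comment> \<open>A shift that makes every exponent \<open>N + e v\<close> nonnegative, so that
    ordinary polynomials suffice.\<close>
  define N where "N = (\<Sum>v\<in>V. \<bar>e v\<bar>)"
  have N: "N + e v \<ge> 0" if "v \<in> V" for v
  proof -
    have "\<bar>e v\<bar> \<le> N" unfolding N_def using V that by (intro member_le_sum) auto
    then show ?thesis by linarith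
  qed
  define f :: "(int poly \<times> nat) \<times> bool \<Rightarrow> 'k poly" where
    "f = (\<lambda>((v, i), b). Polynomial.monom ((if b then - 1 else 1) * (if i = i0 then 1 else 0)) (nat (N + e v)))"
  have v0: "v0 \<in> V" by (simp add: V_def)
  have "Polynomial.coeff (\<Sum>x\<leftarrow>l. f x) (nat (N + e v0))
      = of_nat (count_list l ((v0, i0), False)) - of_nat (count_list l ((v0, i0), True))"
    if "set l \<subseteq> set L" for l
    using that
  proof (induction l)
    case (Cons x l)
    obtain v i b where x: "x = ((v, i), b)" by (metis surj_pair)
    have v: "v \<in> V" using Cons.prems VL[of v i b] x by simp
    have "nat (N + e v) = nat (N + e v0) \<longleftrightarrow> v = v0"
      using N[OF v] N[OF v0] e[OF v] by (auto simp: eq_nat_nat_iff)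
    then show ?case using Cons by (auto simp: x f_def)
  qed simp
  from this[of L] have "Polynomial.coeff (\<Sum>x\<leftarrow>L. f x) (nat (N + e v0)) \<noteq> 0"
    using unbal by simp
  \<comment> \<open>The factor \<open>[:0, 1:]\<close> forces the non-root \<open>t\<close> to be
    nonzero.\<close>
  hence "(\<Sum>x\<leftarrow>L. f x) * [:0, 1:] \<noteq> 0" by auto
  hence "finite {t. poly ((\<Sum>x\<leftarrow>L. f x) * [:0, 1:]) t = 0}" by (rule poly_roots_finite)
  then obtain t where t: "poly ((\<Sum>x\<leftarrow>L. f x) * [:0, 1:]) t \<noteq> 0"
    using ex_new_if_finite[OF infinite_UNIV_char_0] by blast
  have t0: "t \<noteq> 0" using t by auto
  have "poly (\<Sum>x\<leftarrow>l. f x) t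
      = t powi N * (\<Sum>((v, i), b)\<leftarrow>l. (if b then - 1 else 1) * (if i = i0 then t powi (e v) else 0))"
    if "set l \<subseteq> set L" for l
    using that
  proof (induction l)
    case (Cons x l)
    obtain v i b where x: "x = ((v, i), b)" by (metis surj_pair)
    have v: "v \<in> V" using Cons.prems VL[of v i b] x by simp
    have "t ^ nat (N + e v) = t powi (N + e v)" using N[OF v] by (simp add: power_int_def)
    also have "\<dots> = t powi N * t powi (e v)" using t0 by (simp add: power_int_add)
    finally show ?case using Cons by (auto simp: x f_def poly_monom algebra_simps)
  qed simp
  from this[of L] have "(\<Sum>((v, i), b)\<leftarrow>L. (if b then - 1 else 1) * (if i = i0 then t powi (e v) else 0)) \<noteq> 0"
    using t by auto
  then show ?thesis unfolding e_def using t0 by blast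
qed

section \<open>Two-by-two matrices\<close>

definition mat2 :: "'a::zero \<Rightarrow> 'a \<Rightarrow> 'a \<Rightarrow> 'a \<Rightarrow> 'a^2^2" where
  "mat2 a b c d = vector [vector [a, b], vector [c, d]]"

lemma mat2_nth [simp]:
  "mat2 a b c d $ 1 $ 1 = a" "mat2 a b c d $ 1 $ 2 = b"
  "mat2 a b c d $ 2 $ 1 = c" "mat2 a b c d $ 2 $ 2 = d"
  by (simp_all add: mat2_def)

lemma mat2_eq_iff:
  "A = B \<longleftrightarrow> A $ 1 $ 1 = B $ 1 $ 1 \<and> A $ 1 $ 2 = B $ 1 $ 2 \<and> A $ 2 $ 1 = B $ 2 $ 1 \<and> A $ 2 $ 2 = B $ 2 $ 2"
  for A B :: "'a^2^2"
  by (auto simp: vec_eq_iff forall_2)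

lemma matrix_mult_2 [simp]: "(A ** B) $ i $ j = A $ i $ 1 * B $ 1 $ j + A $ i $ 2 * B $ 2 $ j"
  for A B :: "'a::semiring_1^2^2"
  by (simp add: matrix_matrix_mult_def sum_2)

lemma mat_one_2 [simp]:
  "(mat 1 :: 'a::zero_neq_one^2^2) $ 1 $ 1 = 1" "(mat 1 :: 'a^2^2) $ 1 $ 2 = 0"
  "(mat 1 :: 'a^2^2) $ 2 $ 1 = 0" "(mat 1 :: 'a^2^2) $ 2 $ 2 = 1"
  by (simp_all add: mat_def)

definition adj2 :: "'a::comm_ring_1^2^2 \<Rightarrow> 'a^2^2" where
  "adj2 A = mat2 (A $ 2 $ 2) (- A $ 1 $ 2) (- A $ 2 $ 1) (A $ 1 $ 1)"

lemma adj2_nth [simp]: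
  "adj2 A $ 1 $ 1 = A $ 2 $ 2" "adj2 A $ 1 $ 2 = - A $ 1 $ 2"
  "adj2 A $ 2 $ 1 = - A $ 2 $ 1" "adj2 A $ 2 $ 2 = A $ 1 $ 1"
  by (simp_all add: adj2_def)

lemma adj2_inverse:
  assumes "det A = 1"
  shows "adj2 A ** A = mat 1" "A ** adj2 A = mat 1"
  using assms by (simp_all add: mat2_eq_iff det_2 algebra_simps)

text \<open>The word map with inverses replaced by adjugates, so that it is polynomial on all
  of the matrix algebra.\<close>

definition adj_word :: "('i \<times> bool) list \<Rightarrow> ('i \<Rightarrow> 'a::comm_ring_1^2^2) \<Rightarrow> 'a^2^2" where
  "adj_word w Z = foldr (\<lambda>(i, b) acc. (if b then adj2 (Z i) else Z i) ** acc) w (mat 1)"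

lemma adj_word_simps [simp]:
  "adj_word [] Z = mat 1"
  "adj_word ((i, b) # w) Z = (if b then adj2 (Z i) else Z i) ** adj_word w Z"
  by (simp_all add: adj_word_def)

lemma adj_word_cong:
  assumes "\<And>i b. (i, b) \<in> set w \<Longrightarrow> Z i = Y i"
  shows "adj_word w Z = adj_word w Y"
  using assms
proof (induction w)
  case (Cons x w)
  obtain i b where x: "x = (i, b)" by (cases x)
  have "Z i = Y i" using Cons.prems[of i b] x by simp
  moreover have "adj_word w Z = adj_word w Y" by (rule Cons.IH) (use Cons.prems in auto)
  ultimately show ?case by (simp add: x)
qed simp

lemma det_adj2 [simp]: "det (adj2 A) = det A"
  by (simp add: det_2 mult.commute)

lemma det_adj_word:
  assumes "\<And>i. det (Z i) = 1"
  shows "det (adj_word w Z) = 1"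
proof (induction w)
  case (Cons x w)
  then show ?case using assms by (cases x) (simp add: det_mul)
qed simp

text \<open>For tuples in which a matrix used by the word is 0 and so cannot be rescaled to
  determinant 1.\<close>

lemma adj_word_eq_0:
  fixes Z :: "'i \<Rightarrow> 'a::comm_ring_1^2^2"
  assumes "(i, b) \<in> set w" "Z i = 0"
  shows "adj_word w Z = 0"
  using assms(1)
proof (induction w)
  case (Cons x w)
  have "adj2 (0 :: 'a^2^2) = 0" by (simp add: mat2_eq_iff)
  then show ?case using Cons assms(2) by (cases x) auto
qed simp

text \<open>On 2 by 2 matrices \<open>adj2\<close> is linear, so a generator and its inverse both
  contribute the factor \<open>c i\<close>. This reduces tuples of nonzero determinants to tuples in
  SL(2).\<close>

lemma adj_word_scale:
  fixes Z Y :: "'i \<Rightarrow> 'a::comm_ring_1^2^2"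
  assumes "\<And>i b. (i, b) \<in> set w \<Longrightarrow> Z i = (\<chi> j k. c i * Y i $ j $ k)"
  shows "\<exists>\<kappa>. \<forall>j k. adj_word w Z $ j $ k = \<kappa> * adj_word w Y $ j $ k"
  using assms
proof (induction w)
  case Nil
  show ?case by (rule exI[of _ 1]) simp
next
  case (Cons x w)
  obtain i b where x: "x = (i, b)" by (cases x)
  obtain \<kappa> where \<kappa>: "\<And>j k. adj_word w Z $ j $ k = \<kappa> * adj_word w Y $ j $ k"
    using Cons.IH Cons.prems by fastforce
  have "Z i = (\<chi> j k. c i * Y i $ j $ k)" using Cons.prems[of i b] x by simp
  hence "adj_word (x # w) Z $ j $ k = c i * \<kappa> * adj_word (x # w) Y $ j $ k" for j k
    using exhaust_2[of j] by (auto simp: x \<kappa> algebra_simps)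
  then show ?case by blast
qed

lemma adj_word_conj:
  fixes P :: "'a::comm_ring_1^2^2"
  assumes "det P = 1"
  shows "adj_word w (\<lambda>i. P ** Z i ** adj2 P) = P ** adj_word w Z ** adj2 P"
proof -
  note P = adj2_inverse[OF assms]
  have adj: "adj2 (P ** A ** adj2 P) = P ** adj2 A ** adj2 P" for A
    by (simp add: mat2_eq_iff algebra_simps)
  have mult: "(P ** A ** adj2 P) ** (P ** B ** adj2 P) = P ** (A ** B) ** adj2 P" for A B
  proof -
    have "(P ** A ** adj2 P) ** (P ** B ** adj2 P) = P ** A ** (adj2 P ** P) ** B ** adj2 P"
      by (simp only: matrix_mul_assoc)
    then show ?thesis by (simp add: P matrix_mul_assoc)
  qed
  show ?thesis
  proof (induction w)
    case (Cons x w)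
    then show ?case by (cases x) (auto simp: adj mult)
  qed (simp add: P)
qed

section \<open>Triangular matrices\<close>

text \<open>A triangular matrix of determinant 1 with first row R, B is the unipotent matrix of
  parameter B R times a diagonal matrix, which scales later unipotents by the square of R. So the
  product of the two entries sums \<beta> along the path, weighted by the character that sends a
  class \<open>v\<close> to \<open>(s\<^sup>2) powi (poly v (int M))\<close>.\<close>

lemma adj_word_triangular:
  fixes s :: "'k::field" and \<beta> :: "nat \<Rightarrow> 'k" and M :: nat
  assumes s: "s \<noteq> 0"
  defines "T \<equiv> \<lambda>i. mat2 (s ^ (M ^ i)) (\<beta> i / s ^ (M ^ i)) 0 (1 / s ^ (M ^ i))"
  shows "adj_word w T $ 2 $ 1 = 0"
    and "adj_word w T $ 1 $ 1 = s powi (poly (word_class w) (int M))"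
    and "adj_word w T $ 1 $ 1 * adj_word w T $ 2 $ 2 = 1"
    and "(s\<^sup>2) powi (poly v (int M)) * (adj_word w T $ 1 $ 2 * adj_word w T $ 1 $ 1)
      = (\<Sum>((v, i), b)\<leftarrow>path_edges v w. (if b then - 1 else 1) * ((s\<^sup>2) powi (poly v (int M)) * \<beta> i))"
proof -
  have pm: "poly (Polynomial.monom 1 i) (int M) = int (M ^ i)" for i
    by (simp add: poly_monom)
  have T: "T i $ 1 $ 1 = s ^ (M ^ i)" "T i $ 1 $ 2 = \<beta> i / s ^ (M ^ i)"
    "T i $ 2 $ 1 = 0" "T i $ 2 $ 2 = 1 / s ^ (M ^ i)" for i
    by (simp_all add: T_def)
  have 21: "adj_word w T $ 2 $ 1 = 0" for w
  proof (induction w)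
    case (Cons x w)
    then show ?case by (cases x) (simp add: T)
  qed simp
  then show "adj_word w T $ 2 $ 1 = 0" .
  have 11: "adj_word w T $ 1 $ 1 = s powi (poly (word_class w) (int M))" for w
  proof (induction w)
    case (Cons x w)
    obtain i b where x: "x = (i, b)" by (cases x)
    have "adj_word (x # w) T $ 1 $ 1 = (if b then inverse (s ^ (M ^ i)) else s ^ (M ^ i)) * s powi (poly (word_class w) (int M))"
      using Cons by (simp add: x 21 T divide_inverse)
    also have "(if b then inverse (s ^ (M ^ i)) else s ^ (M ^ i)) = s powi (poly (letter_class x) (int M))"
    proof -
      have "s powi (poly (Polynomial.monom 1 i) (int M)) = s ^ (M ^ i)"
        by (simp only: pm power_int_of_nat)
      then show ?thesis by (cases b) (simp_all add: x letter_class_def power_int_minus)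
    qed
    finally show ?case using s by (simp add: power_int_add)
  qed simp
  then show "adj_word w T $ 1 $ 1 = s powi (poly (word_class w) (int M))" .
  have 22: "adj_word w T $ 1 $ 1 * adj_word w T $ 2 $ 2 = 1" for w
  proof -
    have "det (T i) = 1" for i using s by (simp add: T det_2)
    from det_adj_word[of T, OF this, of w] show ?thesis by (simp add: det_2 21)
  qed
  then show "adj_word w T $ 1 $ 1 * adj_word w T $ 2 $ 2 = 1" .
  show "(s\<^sup>2) powi (poly v (int M)) * (adj_word w T $ 1 $ 2 * adj_word w T $ 1 $ 1)
      = (\<Sum>((v, i), b)\<leftarrow>path_edges v w. (if b then - 1 else 1) * ((s\<^sup>2) powi (poly v (int M)) * \<beta> i))"
  proof (induction w arbitrary: v)
    case (Cons x w)
    obtain i b where x: "x = (i, b)" by (cases x)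
    define r R B Q where "r = s ^ (M ^ i)" and "R = adj_word w T $ 1 $ 1"
      and "B = adj_word w T $ 1 $ 2" and "Q = adj_word w T $ 2 $ 2"
    have r: "r \<noteq> 0" using s by (simp add: r_def)
    have RQ: "R * Q = 1" using 22 by (simp add: R_def Q_def)
    have r2: "r\<^sup>2 = (s\<^sup>2) powi (poly (Polynomial.monom 1 i) (int M))"
      by (simp only: r_def pm power_int_of_nat) (simp add: power_mult[symmetric] mult.commute)
    have s2: "s\<^sup>2 \<noteq> 0" using s by simp
    define \<tau> where "\<tau> u = (s\<^sup>2) powi (poly u (int M))" for u
    have IH: "\<tau> v * (B * R)
      = (\<Sum>((v, i), b)\<leftarrow>path_edges v w. (if b then - 1 else 1) * (\<tau> v * \<beta> i))" for v
      using Cons.IH[of v] by (simp add: \<tau>_def B_def R_def)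
    have \<tau>: "\<tau> (u + Polynomial.monom 1 i) = \<tau> u * r\<^sup>2" "\<tau> (u - Polynomial.monom 1 i) = \<tau> u / r\<^sup>2" for u
      using s2 by (simp_all add: \<tau>_def r2 power_int_add power_int_diff)
    have "\<tau> v * (adj_word (x # w) T $ 1 $ 2 * adj_word (x # w) T $ 1 $ 1)
      = (\<Sum>((v, i), b)\<leftarrow>path_edges v (x # w). (if b then - 1 else 1) * (\<tau> v * \<beta> i))"
    proof (cases b)
      case False
      have "adj_word (x # w) T $ 1 $ 2 * adj_word (x # w) T $ 1 $ 1 = (r * B + \<beta> i / r * Q) * (r * R)"
        using False by (simp add: x 21 T r_def B_def Q_def R_def)
      also have "\<dots> = r\<^sup>2 * (B * R) + \<beta> i * (R * Q)"
        using r by (simp add: field_simps power2_eq_square)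
      finally have "\<tau> v * (adj_word (x # w) T $ 1 $ 2 * adj_word (x # w) T $ 1 $ 1)
          = \<tau> v * r\<^sup>2 * (B * R) + \<tau> v * \<beta> i"
        using RQ by (simp add: algebra_simps)
      then show ?thesis using False IH[of "v + Polynomial.monom 1 i"] by (simp add: x letter_class_def \<tau>)
    next
      case True
      have "adj_word (x # w) T $ 1 $ 2 * adj_word (x # w) T $ 1 $ 1 = (1 / r * B - \<beta> i / r * Q) * (1 / r * R)"
        using True by (simp add: x 21 T r_def B_def Q_def R_def)
      also have "\<dots> = (B * R) / r\<^sup>2 - \<beta> i * (R * Q) / r\<^sup>2"
        using r by (simp add: field_simps power2_eq_square)
      finally have "adj_word (x # w) T $ 1 $ 2 * adj_word (x # w) T $ 1 $ 1 = (B * R - \<beta> i) / r\<^sup>2"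
        using RQ by (simp only: mult_1_right diff_divide_distrib)
      \<comment> \<open>Division by \<open>r\<^sup>2\<close> moves the weight to
        \<open>v - Polynomial.monom 1 i\<close>, which is both the next vertex and the tail of the
        edge crossed backwards.\<close>
      hence "\<tau> v * (adj_word (x # w) T $ 1 $ 2 * adj_word (x # w) T $ 1 $ 1)
          = \<tau> v / r\<^sup>2 * (B * R) - \<tau> v / r\<^sup>2 * \<beta> i"
        by (simp only: times_divide_eq_right times_divide_eq_left right_diff_distrib diff_divide_distrib)
      then show ?thesis using True IH[of "v - Polynomial.monom 1 i"] by (simp add: x letter_class_def \<tau>)
    qed
    then show ?case by (simp only: \<tau>_def)
  qed simp
qed

text \<open>Some edge is unbalanced. With \<beta> selecting its direction and \<open>s\<close> a
  square root of the non-root \<open>t\<close>, the upper right entry is the nonzero sum; the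
  diagonal is 1 because \<open>w\<close> has class 0.\<close>

lemma unipotent_value:
  assumes w: "w \<in> derived (free_group n) (carrier (free_group n))"
    and w2: "w \<notin> derived (free_group n) (derived (free_group n) (carrier (free_group n)))"
  shows "\<exists>T :: nat \<Rightarrow> ('k::{alg_closed_field, field_char_0})^2^2. (\<forall>i. det (T i) = 1) \<and>
    adj_word w T $ 1 $ 1 + adj_word w T $ 2 $ 2 = 2 \<and> adj_word w T $ 1 $ 2 \<noteq> 0"
proof -
  obtain v0 i0 where "count_list (path_edges 0 w) ((v0, i0), True) \<noteq> count_list (path_edges 0 w) ((v0, i0), False)"
    using second_derived_if_balanced[OF w] w2 by fastforce
  from unbalanced_edges_nonzero_sum[OF this]
  obtain M :: nat and t :: 'k where t: "t \<noteq> 0"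
    and sum: "(\<Sum>((v, i), b)\<leftarrow>path_edges 0 w. (if b then - 1 else 1) *
      (if i = i0 then t powi (poly v (int M)) else 0)) \<noteq> 0"
    by blast
  obtain s where s: "s\<^sup>2 = t" using nth_root_exists[of 2 t] by auto
  have s0: "s \<noteq> 0" using s t by auto
  define \<beta> :: "nat \<Rightarrow> 'k" where "\<beta> i = (if i = i0 then 1 else 0)" for i
  define T where "T = (\<lambda>i. mat2 (s ^ (M ^ i)) (\<beta> i / s ^ (M ^ i)) 0 (1 / s ^ (M ^ i)))"
  note tri = adj_word_triangular[OF s0, where M = M and \<beta> = \<beta> and w = w, folded T_def]
  have "det (T i) = 1" for i using s0 by (simp add: T_def det_2)
  moreover have 11: "adj_word w T $ 1 $ 1 = 1"
    using tri(2) word_class_derived[OF w] by simp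
  moreover have "adj_word w T $ 2 $ 2 = 1" using tri(3) 11 by simp
  moreover have "adj_word w T $ 1 $ 2 \<noteq> 0"
  proof -
    have "(\<Sum>((v, i), b)\<leftarrow>path_edges 0 w. (if b then - 1 else 1) * ((s\<^sup>2) powi (poly v (int M)) * \<beta> i)) \<noteq> 0"
      using sum by (simp add: s \<beta>_def if_distrib cong: if_cong)
    then show ?thesis using tri(4)[where v = 0] by auto
  qed
  ultimately show ?thesis by (intro exI[of _ T]) simp
qed

section \<open>Polynomial families of matrices\<close>

definition polyfun :: "('a::comm_ring_1 \<Rightarrow> 'a) \<Rightarrow> bool" where
  "polyfun f \<longleftrightarrow> (\<exists>p. f = poly p)"

lemma polyfun_const: "polyfun (\<lambda>t. c)"
  unfolding polyfun_def by (rule exI[of _ "[:c:]"]) auto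

lemma polyfun_ident: "polyfun (\<lambda>t. t)"
  unfolding polyfun_def by (rule exI[of _ "[:0, 1:]"]) auto

lemma polyfun_minus: "polyfun f \<Longrightarrow> polyfun (\<lambda>t. - f t)"
  unfolding polyfun_def fun_eq_iff by (elim exE, rule_tac x = "- p" in exI) simp

lemma polyfun_add: "polyfun f \<Longrightarrow> polyfun g \<Longrightarrow> polyfun (\<lambda>t. f t + g t)"
  unfolding polyfun_def fun_eq_iff by (elim exE, rule_tac x = "p + pa" in exI) simp

lemma polyfun_diff: "polyfun f \<Longrightarrow> polyfun g \<Longrightarrow> polyfun (\<lambda>t. f t - g t)"
  unfolding polyfun_def fun_eq_iff by (elim exE, rule_tac x = "p - pa" in exI) simp

lemma polyfun_mult: "polyfun f \<Longrightarrow> polyfun g \<Longrightarrow> polyfun (\<lambda>t. f t * g t)"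
  unfolding polyfun_def fun_eq_iff by (elim exE, rule_tac x = "p * pa" in exI) simp

lemmas polyfun_intros =
  polyfun_const polyfun_ident polyfun_minus polyfun_add polyfun_diff polyfun_mult

lemma polyfun_adj_word:
  fixes Z :: "'i \<Rightarrow> 'a::comm_ring_1 \<Rightarrow> 'a^2^2"
  assumes "\<And>i j k. polyfun (\<lambda>t. Z i t $ j $ k)"
  shows "polyfun (\<lambda>t. adj_word w (\<lambda>i. Z i t) $ j $ k)"
proof (induction w arbitrary: j k)
  case Nil
  show ?case by (simp add: polyfun_intros)
next
  case (Cons x w)
  obtain i b where x: "x = (i, b)" by (cases x)
  show ?case
    using exhaust_2[of j] assms Cons
    by (cases b) (auto simp: x intro!: polyfun_intros)
qed

lemma polyfun_eq_0_if_vanishes_on_Ints: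
  fixes f :: "'a::{idom, ring_char_0} \<Rightarrow> 'a"
  assumes "polyfun f" "\<And>m. f (of_int m) = 0"
  shows "f t = 0"
proof -
  obtain p where p: "f = poly p" using assms(1) by (auto simp: polyfun_def)
  have "range of_int \<subseteq> {x. poly p x = 0}" using assms(2) p by auto
  moreover have "infinite (range (of_int :: int \<Rightarrow> 'a))"
    using finite_imageD[of "of_int :: int \<Rightarrow> 'a" UNIV] infinite_UNIV_int by (auto simp: inj_on_def)
  ultimately have "infinite {x. poly p x = 0}" using finite_subset by blast
  hence "p = 0" using poly_roots_finite by blast
  then show ?thesis using p by simp
qed

text \<open>Each \<open>A\<close> is a product of four unitriangular matrices; multiplying their
  parameters by \<open>t\<close> connects it to the identity.\<close>

lemma SL2_polynomial_path:
  fixes A :: "'k::field^2^2"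
  assumes "det A = 1"
  shows "\<exists>\<gamma>. (\<forall>j k. polyfun (\<lambda>t. \<gamma> t $ j $ k)) \<and> (\<forall>t. det (\<gamma> t) = 1) \<and> \<gamma> 0 = mat 1 \<and> \<gamma> 1 = A"
proof -
  define p q r s where "p = A $ 1 $ 1" and "q = A $ 1 $ 2" and "r = A $ 2 $ 1" and "s = A $ 2 $ 2"
  have d: "p * s - q * r = 1" using assms by (simp add: det_2 p_def q_def r_def s_def)
  \<comment> \<open>Splitting off the last factor, with parameter \<open>u\<close>, leaves the lower
    left entry \<open>r - u * s\<close>, by which \<open>x\<close> and \<open>z\<close> are divided.
    If \<open>r = 0\<close>, then \<open>s\<close> is nonzero and \<open>u = 1\<close>
    works.\<close>
  obtain u where u: "r - u * s \<noteq> 0"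
    using d by (cases "r = 0") (force intro: that[of 1], force intro: that[of 0])
  define y where "y = r - u * s"
  define x where "x = (p - u * q - 1) / y"
  define z where "z = (s - 1) / y"
  define \<gamma> where "\<gamma> t = mat2 1 (t * x) 0 1 ** mat2 1 0 (t * y) 1 ** mat2 1 (t * z) 0 1 ** mat2 1 0 (t * u) 1" for t
  have y: "y \<noteq> 0" using u by (simp add: y_def)
  have "polyfun (\<lambda>t. \<gamma> t $ j $ k)" for j k
    using exhaust_2[of j] exhaust_2[of k] by (auto simp: \<gamma>_def intro!: polyfun_intros)
  moreover have "det (\<gamma> t) = 1" for t by (simp add: \<gamma>_def det_mul) (simp add: det_2)
  moreover have "\<gamma> 0 = mat 1" by (simp add: \<gamma>_def mat2_eq_iff)
  moreover have "\<gamma> 1 = A"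
  proof -
    have xy: "x * y = p - u * q - 1" and yz: "y * z = s - 1" using y by (simp_all add: x_def z_def)
    have a: "1 + x * y = p - u * q" using xy by simp
    have "y * ((p - u * q) * z + x) = (p - u * q) * (y * z) + x * y" by (simp add: algebra_simps)
    also have "\<dots> = (p - u * q) * (s - 1) + (p - u * q - 1)" by (simp only: xy yz)
    also have "\<dots> = y * q" using d by (simp add: y_def algebra_simps)
    finally have b: "(p - u * q) * z + x = q" using y by simp
    have c: "y * z + 1 = s" using yz by simp
    have "\<gamma> 1 = mat2 (1 + x * y) ((1 + x * y) * z + x) y (y * z + 1) ** mat2 1 0 u 1"
      by (simp add: \<gamma>_def mat2_eq_iff)
    also have "\<dots> = mat2 (p - u * q) q y s ** mat2 1 0 u 1" by (simp only: a b c)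
    also have "\<dots> = A" by (simp add: mat2_eq_iff y_def p_def q_def r_def s_def algebra_simps)
    finally show ?thesis .
  qed
  ultimately show ?thesis by blast
qed

lemma adj_word_one: "adj_word w (\<lambda>i. mat 1) = (mat 1 :: 'a::comm_ring_1^2^2)"
proof (induction w)
  case (Cons x w)
  have "adj2 (mat 1 :: 'a^2^2) = mat 1" by (simp add: mat2_eq_iff)
  then show ?case using Cons by (cases x) simp
qed simp

text \<open>Along polynomial paths from the trivial tuple to \<open>Y\<close> the trace is a
  polynomial, equal to 2 at 0 but not at 1; being nonconstant, it takes every value over an
  algebraically closed field.\<close>

lemma adj_word_traces:
  fixes Y :: "nat \<Rightarrow> 'k::alg_closed_field^2^2"
  assumes Y: "\<And>i. det (Y i) = 1"
    and tr: "adj_word w Y $ 1 $ 1 + adj_word w Y $ 2 $ 2 \<noteq> 2"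
  shows "\<exists>Z :: nat \<Rightarrow> 'k^2^2. (\<forall>i. det (Z i) = 1) \<and> adj_word w Z $ 1 $ 1 + adj_word w Z $ 2 $ 2 = c"
proof -
  have "\<forall>i. \<exists>\<gamma>. (\<forall>j k. polyfun (\<lambda>t. \<gamma> t $ j $ k)) \<and> (\<forall>t. det (\<gamma> t) = 1) \<and> \<gamma> 0 = mat 1 \<and> \<gamma> 1 = Y i"
    using SL2_polynomial_path[OF Y] by blast
  from choice[OF this] obtain \<gamma> where "\<forall>i. (\<forall>j k. polyfun (\<lambda>t. \<gamma> i t $ j $ k)) \<and>
      (\<forall>t. det (\<gamma> i t) = 1) \<and> \<gamma> i 0 = mat 1 \<and> \<gamma> i 1 = Y i"
    by blast
  hence \<gamma>: "\<And>i j k. polyfun (\<lambda>t. \<gamma> i t $ j $ k)" "\<And>i t. det (\<gamma> i t) = 1"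
    "\<And>i. \<gamma> i 0 = mat 1" "\<And>i. \<gamma> i 1 = Y i"
    by blast+
  have "polyfun (\<lambda>t. adj_word w (\<lambda>i. \<gamma> i t) $ 1 $ 1 + adj_word w (\<lambda>i. \<gamma> i t) $ 2 $ 2)"
    by (intro polyfun_intros polyfun_adj_word \<gamma>)
  then obtain p where "\<forall>t. adj_word w (\<lambda>i. \<gamma> i t) $ 1 $ 1 + adj_word w (\<lambda>i. \<gamma> i t) $ 2 $ 2 = poly p t"
    unfolding polyfun_def fun_eq_iff by blast
  hence p: "\<And>t. adj_word w (\<lambda>i. \<gamma> i t) $ 1 $ 1 + adj_word w (\<lambda>i. \<gamma> i t) $ 2 $ 2 = poly p t"
    by blast
  have "poly p 0 = 2" using p[of 0] by (simp add: \<gamma> adj_word_one)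
  moreover have "poly p 1 \<noteq> 2" using p[of 1] tr by (simp add: \<gamma>)
  ultimately have "poly (p - [:c:]) 0 \<noteq> poly (p - [:c:]) 1" by simp
  hence "Polynomial.degree (p - [:c:]) \<noteq> 0" by (metis degree_eq_zeroE poly_pCons poly_0 mult_zero_right)
  hence "Polynomial.degree (p - [:c:]) > 0" by simp
  then obtain t where "poly (p - [:c:]) t = 0" using alg_closed_imp_poly_has_root by blast
  hence "adj_word w (\<lambda>i. \<gamma> i t) $ 1 $ 1 + adj_word w (\<lambda>i. \<gamma> i t) $ 2 $ 2 = c" using p[of t] by simp
  then show ?thesis using \<gamma>(2) by (intro exI[of _ "\<lambda>i. \<gamma> i t"]) simp
qed

section \<open>Integral quaternions\<close>

text \<open>If \<open>I\<close> is a square root of -1, this is the usual matrix of the quaternion a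
  + bi + cj + dk; \<open>adj2\<close> is then quaternion conjugation and \<open>det\<close> the
  norm.\<close>

definition quaternion :: "'a::comm_ring_1 \<Rightarrow> 'a \<Rightarrow> 'a \<Rightarrow> 'a \<Rightarrow> 'a \<Rightarrow> 'a^2^2" where
  "quaternion I a b c d = mat2 (a + b * I) (c + d * I) (- c + d * I) (a - b * I)"

lemma quaternion_nth [simp]:
  "quaternion I a b c d $ 1 $ 1 = a + b * I" "quaternion I a b c d $ 1 $ 2 = c + d * I"
  "quaternion I a b c d $ 2 $ 1 = - c + d * I" "quaternion I a b c d $ 2 $ 2 = a - b * I"
  by (simp_all add: quaternion_def)

definition int_quaternions :: "'a::comm_ring_1 \<Rightarrow> ('a^2^2) set" where
  "int_quaternions I = {quaternion I (of_int a) (of_int b) (of_int c) (of_int d) | a b c d. True}"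

lemma quaternion_mult:
  assumes "I * I = - 1"
  shows "quaternion I a b c d ** quaternion I a' b' c' d' = quaternion I (a * a' - b * b' - c * c' - d * d')
    (a * b' + b * a' + c * d' - d * c') (a * c' - b * d' + c * a' + d * b') (a * d' + b * c' - c * b' + d * a')"
proof -
  have I: "I * (I * z) = - z" for z using assms by (simp add: mult.assoc[symmetric])
  show ?thesis by (simp add: mat2_eq_iff algebra_simps I assms)
qed

lemma det_quaternion: "I * I = - 1 \<Longrightarrow> det (quaternion I a b c d) = a\<^sup>2 + b\<^sup>2 + c\<^sup>2 + d\<^sup>2"
proof -
  assume I: "I * I = - 1"
  have "det (quaternion I a b c d) = a\<^sup>2 + c\<^sup>2 - (b\<^sup>2 + d\<^sup>2) * (I * I)"
    by (simp add: det_2 algebra_simps power2_eq_square)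
  then show ?thesis by (simp add: I)
qed

lemma int_quaternions_adj_word:
  fixes Z :: "'i \<Rightarrow> 'a::comm_ring_1^2^2"
  assumes I: "I * I = - 1" and Z: "\<And>i. Z i \<in> int_quaternions I"
  shows "adj_word w Z \<in> int_quaternions I"
proof (induction w)
  case Nil
  have "mat 1 = quaternion I (of_int 1) (of_int 0) (of_int 0) (of_int 0)" by (simp add: mat2_eq_iff)
  then show ?case unfolding int_quaternions_def adj_word_simps by blast
next
  case (Cons x w)
  obtain i b where x: "x = (i, b)" by (cases x)
  have adj: "adj2 q \<in> int_quaternions I" if q: "q \<in> int_quaternions I" for q :: "'a^2^2"
  proof -
    obtain a b c d where "q = quaternion I (of_int a) (of_int b) (of_int c) (of_int d)"
      using q by (auto simp: int_quaternions_def)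
    hence "adj2 q = quaternion I (of_int a) (of_int (- b)) (of_int (- c)) (of_int (- d))"
      by (simp add: mat2_eq_iff)
    then show ?thesis unfolding int_quaternions_def by blast
  qed
  have mult: "q ** q' \<in> int_quaternions I" if q: "q \<in> int_quaternions I" "q' \<in> int_quaternions I" for q q' :: "'a^2^2"
  proof -
    obtain a b c d a' b' c' d' where "q = quaternion I (of_int a) (of_int b) (of_int c) (of_int d)"
      "q' = quaternion I (of_int a') (of_int b') (of_int c') (of_int d')"
      using q by (auto simp: int_quaternions_def)
    hence "q ** q' = quaternion I (of_int (a * a' - b * b' - c * c' - d * d'))
      (of_int (a * b' + b * a' + c * d' - d * c')) (of_int (a * c' - b * d' + c * a' + d * b'))
      (of_int (a * d' + b * c' - c * b' + d * a'))"
      by (simp add: quaternion_mult[OF I])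
    then show ?thesis unfolding int_quaternions_def by blast
  qed
  show ?case using Cons Z adj mult by (simp add: x)
qed

text \<open>The norm form is anisotropic over the integers, so a norm-one quaternion of trace 2 is 1.\<close>

lemma adj_word_int_quaternions_diagonal:
  fixes Z :: "nat \<Rightarrow> 'k::{alg_closed_field, field_char_0}^2^2"
  assumes I: "I * I = - 1" and Z: "\<And>i. Z i \<in> int_quaternions I"
    and tr: "\<And>Y :: nat \<Rightarrow> 'k^2^2. (\<And>i. det (Y i) = 1) \<Longrightarrow> adj_word w Y $ 1 $ 1 + adj_word w Y $ 2 $ 2 = 2"
  shows "adj_word w Z $ 1 $ 2 = 0"
proof (cases "\<exists>i b. (i, b) \<in> set w \<and> Z i = 0")
  case True
  then show ?thesis using adj_word_eq_0 by (metis zero_index)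
next
  case False
  have sq0: "b = 0 \<and> c = 0 \<and> d = 0" if "of_int a * of_int a + of_int b * of_int b + of_int c * of_int c + of_int d * of_int d = (of_int a * of_int a :: 'k)"
    for a b c d :: int
  proof -
    have "(of_int (b * b + c * c + d * d) :: 'k) = of_int 0"
      using that by (simp add: add.assoc)
    hence "b * b + c * c + d * d = 0" by (simp only: of_int_eq_iff)
    then show ?thesis by (smt (verit) mult_eq_0_iff zero_le_square)
  qed
  have nz: "det (Z i) \<noteq> 0" if "Z i \<noteq> 0" for i
  proof
    assume d0: "det (Z i) = 0"
    obtain a b c d where q: "Z i = quaternion I (of_int a) (of_int b) (of_int c) (of_int d)"
      using Z[of i] by (auto simp: int_quaternions_def)
    have "(of_int (a * a + b * b + c * c + d * d) :: 'k) = of_int 0"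
      using d0 by (simp add: q det_quaternion[OF I] power2_eq_square)
    hence "a * a + b * b + c * c + d * d = 0" by (simp only: of_int_eq_iff)
    hence "a = 0 \<and> b = 0 \<and> c = 0 \<and> d = 0" by (smt (verit) mult_eq_0_iff zero_le_square)
    then show False using that by (simp add: q mat2_eq_iff)
  qed
  have "\<forall>i. \<exists>r. r\<^sup>2 = det (Z i)" by (metis nth_root_exists zero_less_numeral)
  then obtain r where r: "\<And>i. (r i)\<^sup>2 = det (Z i)" by metis
  \<comment> \<open>Normalization by a square root of the norm. Zero quaternions get the placeholder
    \<open>mat 1\<close>; in this case no letter of \<open>w\<close> refers to them.\<close>
  define Y where "Y i = (if Z i = 0 then mat 1 else (\<chi> j k. Z i $ j $ k / r i))" for i
  have "det (Y i) = 1" for i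
  proof (cases "Z i = 0")
    case False
    hence "r i \<noteq> 0" using nz r[of i] by force
    moreover have "det (Y i) = det (Z i) / (r i)\<^sup>2"
      using False by (simp add: Y_def det_2 power2_eq_square diff_divide_distrib)
    ultimately show ?thesis by (simp add: r[symmetric])
  qed (simp add: Y_def)
  note Y = this
  have "Z i = (\<chi> j k. r i * Y i $ j $ k)" if "(i, b) \<in> set w" for i b
  proof -
    have "Z i \<noteq> 0" using that False by blast
    moreover from this have "r i \<noteq> 0" using nz r[of i] by force
    ultimately show ?thesis by (simp add: Y_def)
  qed
  hence "\<exists>\<kappa>. \<forall>j k. adj_word w Z $ j $ k = \<kappa> * adj_word w Y $ j $ k"
    by (intro adj_word_scale) blast
  then obtain \<kappa> where \<kappa>: "\<And>j k. adj_word w Z $ j $ k = \<kappa> * adj_word w Y $ j $ k" by blast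
  obtain a b c d where q: "adj_word w Z = quaternion I (of_int a) (of_int b) (of_int c) (of_int d)"
    using int_quaternions_adj_word[of I Z w, OF I Z] by (auto simp: int_quaternions_def)
  \<comment> \<open>Since \<open>adj_word w Y\<close> has trace 2 and determinant 1, the value at
    \<open>Z\<close> has trace \<open>2 * \<kappa>\<close> and norm
    \<open>\<kappa> * \<kappa>\<close>. Its real part is thus \<kappa>, whose square already
    exhausts the norm.\<close>
  have "adj_word w Z $ 1 $ 1 + adj_word w Z $ 2 $ 2 = \<kappa> * (adj_word w Y $ 1 $ 1 + adj_word w Y $ 2 $ 2)"
    by (simp only: \<kappa> distrib_left)
  also have "\<dots> = 2 * \<kappa>" by (simp only: tr[of Y, OF Y] mult.commute)
  finally have a: "\<kappa> = of_int a" by (simp add: q)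
  have "det (adj_word w Z) = \<kappa> * \<kappa> * det (adj_word w Y)"
    by (simp add: det_2 \<kappa> algebra_simps)
  hence "of_int a * of_int a + of_int b * of_int b + of_int c * of_int c + of_int d * of_int d = (of_int a * of_int a :: 'k)"
    by (simp only: det_adj_word[of Y, OF Y] q det_quaternion[OF I] power2_eq_square a mult_1_right)
  from sq0[OF this] show ?thesis by (simp add: q)
qed

text \<open>If the trace were always 2, the upper right entry would vanish on integral quaternions,
  hence, being polynomial in the coordinates, on all matrices, in particular at
  \<open>T\<close>.\<close>

lemma exists_trace_ne_2:
  fixes T :: "nat \<Rightarrow> 'k::{alg_closed_field, field_char_0}^2^2"
  assumes T: "adj_word w T $ 1 $ 2 \<noteq> 0" and w: "set w \<subseteq> {..<n} \<times> UNIV"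
  shows "\<exists>Y :: nat \<Rightarrow> 'k^2^2. (\<forall>i. det (Y i) = 1) \<and> adj_word w Y $ 1 $ 1 + adj_word w Y $ 2 $ 2 \<noteq> 2"
proof (rule ccontr)
  assume "\<not> ?thesis"
  hence tr: "adj_word w Y $ 1 $ 1 + adj_word w Y $ 2 $ 2 = 2" if "\<And>i. det (Y i) = 1" for Y :: "nat \<Rightarrow> 'k^2^2"
    using that by blast
  obtain I :: 'k where "I\<^sup>2 = - 1" using nth_root_exists[of 2 "- 1 :: 'k"] by auto
  hence I: "I * I = - 1" by (simp add: power2_eq_square)
  \<comment> \<open>Four consecutive terms of one sequence \<open>p\<close> are the coordinates of
    each quaternion, so that coordinates can be freed one at a time.\<close>
  define Q where "Q p i = quaternion I (p (4 * i)) (p (4 * i + 1)) (p (4 * i + 2)) (p (4 * i + 3))"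
    for p :: "nat \<Rightarrow> 'k" and i
  \<comment> \<open>The first \<open>k\<close> coordinates are arbitrary, the others integral. The
    induction step varies coordinate \<open>k\<close> alone: the entry is a polynomial in it that
    has every integer as a root.\<close>
  have vanish: "adj_word w (Q p) $ 1 $ 2 = 0" if "\<And>m. m \<ge> k \<Longrightarrow> p m \<in> \<int>" for k p
    using that
  proof (induction k arbitrary: p)
    case 0
    have "Q p i \<in> int_quaternions I" for i
    proof -
      obtain a b c d where "p (4 * i) = of_int a" "p (4 * i + 1) = of_int b"
        "p (4 * i + 2) = of_int c" "p (4 * i + 3) = of_int d"
        using 0 by (metis Ints_cases le0)
      hence "Q p i = quaternion I (of_int a) (of_int b) (of_int c) (of_int d)" by (simp add: Q_def)
      then show ?thesis unfolding int_quaternions_def by blast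
    qed
    then show ?case by (rule adj_word_int_quaternions_diagonal[OF I _ tr])
  next
    case (Suc k)
    have upd: "polyfun (\<lambda>t. (p(k := t)) m)" for m
      by (cases "m = k") (simp_all add: polyfun_intros)
    have "polyfun (\<lambda>t. Q (p(k := t)) i $ j $ l)" for i j l
      using exhaust_2[of j] exhaust_2[of l] upd unfolding Q_def
      by (auto simp del: fun_upd_apply intro!: polyfun_intros)
    hence "polyfun (\<lambda>t. adj_word w (Q (p(k := t))) $ 1 $ 2)"
      using polyfun_adj_word[of "\<lambda>i t. Q (p(k := t)) i" w 1 2] by simp
    moreover have "adj_word w (Q (p(k := of_int m))) $ 1 $ 2 = 0" for m
      by (rule Suc.IH) (use Suc.prems in auto)
    ultimately have "adj_word w (Q (p(k := p k))) $ 1 $ 2 = 0"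
      by (rule polyfun_eq_0_if_vanishes_on_Ints)
    then show ?case by simp
  qed
  have I0: "I \<noteq> 0" using I by auto
  \<comment> \<open>Coordinates in the basis 1, i, j, k: as 2 and \<open>I\<close> are invertible,
    quaternions over K fill the matrix algebra.\<close>
  define coord where "coord A j = (if j = 0 then (A $ 1 $ 1 + A $ 2 $ 2) / 2
    else if j = 1 then (A $ 1 $ 1 - A $ 2 $ 2) / (2 * I)
    else if j = 2 then (A $ 1 $ 2 - A $ 2 $ 1) / 2 else (A $ 1 $ 2 + A $ 2 $ 1) / (2 * I))"
    for A :: "'k^2^2" and j :: nat
  have coord: "quaternion I (coord A 0) (coord A 1) (coord A 2) (coord A 3) = A" for A
    using I0 by (simp add: coord_def mat2_eq_iff field_simps)
  define p where "p m = (if m < 4 * n then coord (T (m div 4)) (m mod 4) else 0)" for m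
  have "Q p i = T i" if "i < n" for i
  proof -
    have "p (4 * i + j) = coord (T i) j" if "j < 4" for j
      using \<open>i < n\<close> that by (simp add: p_def)
    from this[of 0] this[of 1] this[of 2] this[of 3] show ?thesis
      using coord[of "T i"] by (simp add: Q_def)
  qed
  hence "adj_word w (Q p) = adj_word w T" using w by (intro adj_word_cong) auto
  moreover have "adj_word w (Q p) $ 1 $ 2 = 0" by (rule vanish[of "4 * n"]) (simp add: p_def)
  ultimately show False using T by simp
qed

section \<open>Conjugacy in SL(2) and the passage to PSL(2)\<close>

definition scalar2 :: "'a::zero^2^2 \<Rightarrow> bool" where
  "scalar2 A \<longleftrightarrow> A $ 1 $ 2 = 0 \<and> A $ 2 $ 1 = 0 \<and> A $ 1 $ 1 = A $ 2 $ 2"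

text \<open>A matrix that is not scalar has a cyclic vector \<open>v\<close>; the base change with columns
  \<open>v\<close>, \<open>A v\<close> can be scaled to determinant 1.\<close>

lemma conj_companion:
  fixes A :: "'k::alg_closed_field^2^2"
  assumes d: "det A = 1" and ns: "\<not> scalar2 A"
  shows "\<exists>P. det P = 1 \<and> A = P ** mat2 0 (- 1) 1 (A $ 1 $ 1 + A $ 2 $ 2) ** adj2 P"
proof -
  define p q r s where "p = A $ 1 $ 1" and "q = A $ 1 $ 2" and "r = A $ 2 $ 1" and "s = A $ 2 $ 2"
  have A: "A = mat2 p q r s" by (simp add: mat2_eq_iff p_def q_def r_def s_def)
  have d': "p * s = 1 + q * r" using d by (simp add: A det_2 algebra_simps)
  \<comment> \<open>The expression is the determinant with columns \<open>v = (x, y)\<close> and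
    \<open>A v\<close>. If it vanished at (1,0), (0,1) and (1,1), then \<open>A\<close> would be
    scalar.\<close>
  have "\<exists>x y. x * (r * x + s * y) - y * (p * x + q * y) \<noteq> 0"
  proof (rule ccontr)
    assume "\<not> ?thesis"
    hence *: "x * (r * x + s * y) - y * (p * x + q * y) = 0" for x y by blast
    have "r = 0" "q = 0" using *[of 1 0] *[of 0 1] by simp_all
    moreover have "p = s" using *[of 1 1] calculation by simp
    ultimately show False using ns by (simp add: scalar2_def A)
  qed
  then obtain x y where xy: "x * (r * x + s * y) - y * (p * x + q * y) \<noteq> 0" by blast
  define D where "D = x * (r * x + s * y) - y * (p * x + q * y)"
  \<comment> \<open>\<open>D\<close> is quadratic in \<open>(x, y)\<close>, so dividing both by a
    square root of \<open>D\<close> gives determinant 1.\<close>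
  obtain \<rho> where \<rho>: "\<rho>\<^sup>2 = D" using nth_root_exists[of 2 D] by auto
  have \<rho>0: "\<rho> \<noteq> 0" using \<rho> xy by (auto simp: D_def)
  define x' y' where "x' = x / \<rho>" and "y' = y / \<rho>"
  have D': "x' * (r * x' + s * y') - y' * (p * x' + q * y') = 1"
  proof -
    have "x' * (r * x' + s * y') - y' * (p * x' + q * y') = D / \<rho>\<^sup>2"
      using \<rho>0 by (simp add: x'_def y'_def D_def field_simps power2_eq_square)
    then show ?thesis using \<rho>0 by (simp add: \<rho>[symmetric])
  qed
  define P where "P = mat2 x' (p * x' + q * y') y' (r * x' + s * y')"
  have dP: "det P = 1" using D' by (simp add: P_def det_2 mult.commute)
  \<comment> \<open>Cayley-Hamilton: \<open>A\<close> maps the second column \<open>A v\<close> to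
    \<open>(p + s) A v - v\<close>.\<close>
  have "P ** mat2 0 (- 1) 1 (p + s) = A ** P"
  proof -
    have "p * (p * x') + q * (r * x') + (p * (q * y') + q * (s * y')) = (p * x' + q * y') * (p + s) - x' * (p * s - q * r)"
      by (simp add: algebra_simps)
    moreover have "r * (p * x') + s * (r * x') + (r * (q * y') + s * (s * y')) = (r * x' + s * y') * (p + s) - y' * (p * s - q * r)"
      by (simp add: algebra_simps)
    ultimately show ?thesis using d' by (simp add: P_def A mat2_eq_iff algebra_simps)
  qed
  hence "P ** mat2 0 (- 1) 1 (p + s) ** adj2 P = A ** (P ** adj2 P)" by (simp add: matrix_mul_assoc)
  then show ?thesis using dP adj2_inverse(2)[OF dP] by (intro exI[of _ P]) (simp add: p_def s_def)
qed

text \<open>Both matrices are conjugate to one companion matrix, and conjugating all of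
  \<open>Z\<close> conjugates the value of the word.\<close>

lemma adj_word_value_if_same_trace:
  fixes A :: "'k::alg_closed_field^2^2"
  assumes A: "det A = 1" "\<not> scalar2 A"
    and Z: "\<And>i. det (Z i) = 1" "\<not> scalar2 (adj_word w Z)"
    and tr: "adj_word w Z $ 1 $ 1 + adj_word w Z $ 2 $ 2 = A $ 1 $ 1 + A $ 2 $ 2"
  shows "\<exists>Y. (\<forall>i. det (Y i) = 1) \<and> adj_word w Y = A"
proof -
  define C where "C = mat2 0 (- 1) 1 (A $ 1 $ 1 + A $ 2 $ 2)"
  obtain P where P: "det P = 1" "A = P ** C ** adj2 P"
    using conj_companion[OF A] by (auto simp: C_def)
  obtain R where R: "det R = 1" "adj_word w Z = R ** C ** adj2 R"
    using conj_companion[OF det_adj_word[of Z w, OF Z(1)] Z(2)] by (auto simp: C_def tr)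
  note RR = adj2_inverse(1)[OF R(1)]
  define S where "S = P ** adj2 R"
  have S: "det S = 1" using P R by (simp add: S_def det_mul)
  have "adj2 S = R ** adj2 P" by (simp add: S_def mat2_eq_iff algebra_simps)
  hence "S ** adj_word w Z ** adj2 S = P ** (adj2 R ** R) ** C ** (adj2 R ** R) ** adj2 P"
    by (simp only: S_def R(2) matrix_mul_assoc)
  hence "adj_word w (\<lambda>i. S ** Z i ** adj2 S) = A"
    by (simp add: adj_word_conj[OF S] RR P(2))
  moreover have "det (S ** Z i ** adj2 S) = 1" for i using S Z(1) by (simp add: det_mul)
  ultimately show ?thesis by (intro exI[of _ "\<lambda>i. S ** Z i ** adj2 S"]) simp
qed

section \<open>The groups SL(2,K) and PSL(2,K)\<close>

lemma SL2_simps [simp]: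
  "A \<in> carrier SL2 \<longleftrightarrow> det A = 1" "A \<otimes>\<^bsub>SL2\<^esub> B = A ** B" "\<one>\<^bsub>SL2\<^esub> = mat 1"
  by (simp_all add: SL2_def)

lemma group_SL2: "group (SL2 :: ('k::field^2^2) monoid)"
proof (rule groupI)
  fix A B C :: "'k^2^2"
  show "A \<otimes>\<^bsub>SL2\<^esub> B \<otimes>\<^bsub>SL2\<^esub> C = A \<otimes>\<^bsub>SL2\<^esub> (B \<otimes>\<^bsub>SL2\<^esub> C)" by (simp add: matrix_mul_assoc)
  assume A: "A \<in> carrier SL2"
  show "\<exists>B\<in>carrier SL2. B \<otimes>\<^bsub>SL2\<^esub> A = \<one>\<^bsub>SL2\<^esub>"
    using A adj2_inverse(1)[of A] by (intro bexI[of _ "adj2 A"]) simp_all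
qed (simp_all add: det_mul)

lemma signed_prod_SL2:
  assumes "\<And>i. det (Z i) = 1"
  shows "signed_prod (SL2 :: ('k::field^2^2) monoid) Z w = adj_word w Z"
proof (induction w)
  case (Cons x w)
  have "inv\<^bsub>SL2\<^esub> (Z i) = adj2 (Z i)" for i
    using assms adj2_inverse(1)[of "Z i"] by (intro group.inv_equality[OF group_SL2]) simp_all
  then show ?case using Cons by (cases x) simp
qed simp

lemma normal_center_SL2: "{mat 1, - mat 1} \<lhd> (SL2 :: ('k::field^2^2) monoid)"
proof -
  interpret S: group "SL2 :: ('k^2^2) monoid" by (rule group_SL2)
  have det: "det (- mat 1 :: 'k^2^2) = 1" by (simp add: det_2)
  have neg: "- mat 1 ** - mat 1 = (mat 1 :: 'k^2^2)" by (simp add: mat2_eq_iff)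
  have invneg: "inv\<^bsub>SL2\<^esub> (- mat 1) = (- mat 1 :: 'k^2^2)"
    using det neg by (intro S.inv_equality) simp_all
  have inv1: "inv\<^bsub>SL2\<^esub> (mat 1) = (mat 1 :: 'k^2^2)"
    by (intro S.inv_equality) simp_all
  have sub: "subgroup {mat 1, - mat 1} (SL2 :: ('k^2^2) monoid)"
    by (rule S.subgroupI) (use det neg invneg inv1 in auto)
  show ?thesis
  proof (rule S.normalI[OF sub], intro ballI)
    fix A :: "'k^2^2"
    have "- mat 1 ** A = A ** - mat 1" by (simp add: mat2_eq_iff)
    then show "{mat 1, - mat 1} #>\<^bsub>SL2\<^esub> A = A <#\<^bsub>SL2\<^esub> {mat 1, - mat 1}"
      by (simp add: r_coset_def l_coset_def)
  qed
qed

lemma (in group_hom) hom_signed_prod: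
  assumes "\<And>i. E i \<in> carrier G"
  shows "h (signed_prod G E l) = signed_prod H (\<lambda>i. h (E i)) l"
proof (induction l)
  case (Cons x l)
  have "signed_prod G E l \<in> carrier G"
    using assms by (intro G.signed_prod_in_subgroup[OF G.subgroup_self]) auto
  then show ?case using Cons assms by (cases x) simp
qed simp

theorem theorem1p3:
  fixes n :: nat and w :: "letter list"
  assumes "n \<ge> 2"
    and "w \<in> derived (free_group n) (carrier (free_group n))"
    and "w \<notin> derived (free_group n) (derived (free_group n) (carrier (free_group n)))"
  shows "word_map_surjective (PSL2 :: ('k::{alg_closed_field, field_char_0} ^ 2 ^ 2) set monoid) n w"
proof -
  interpret F: group "free_group n" by (rule group_free_group)
  have "w \<in> carrier (free_group n)"
    using assms(2) F.derived_in_carrier[OF subset_refl] by blast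
  hence w: "set w \<subseteq> {..<n} \<times> UNIV" by (simp add: in_carrier_free_group)
  obtain T :: "nat \<Rightarrow> 'k^2^2" where T: "\<And>i. det (T i) = 1"
    and trT: "adj_word w T $ 1 $ 1 + adj_word w T $ 2 $ 2 = 2" and T12: "adj_word w T $ 1 $ 2 \<noteq> 0"
    using unipotent_value[OF assms(2,3)] by blast
  have nonscalar: "\<exists>Z :: nat \<Rightarrow> 'k^2^2. (\<forall>i. det (Z i) = 1) \<and> \<not> scalar2 (adj_word w Z) \<and>
      adj_word w Z $ 1 $ 1 + adj_word w Z $ 2 $ 2 = c" if c: "c \<noteq> - 2" for c
  proof (cases "c = 2")
    case True
    then show ?thesis using T trT T12 by (intro exI[of _ T]) (simp add: scalar2_def)
  next
    case False
    obtain Y :: "nat \<Rightarrow> 'k^2^2" where Y: "\<And>i. det (Y i) = 1"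
      "adj_word w Y $ 1 $ 1 + adj_word w Y $ 2 $ 2 \<noteq> 2"
      using exists_trace_ne_2[OF T12 w] by blast
    obtain Z :: "nat \<Rightarrow> 'k^2^2" where Z: "\<And>i. det (Z i) = 1"
      "adj_word w Z $ 1 $ 1 + adj_word w Z $ 2 $ 2 = c"
      using adj_word_traces[OF Y] by blast
    \<comment> \<open>A scalar matrix of determinant 1 has trace 2 or -2, both excluded
      here.\<close>
    have "\<not> scalar2 (adj_word w Z)"
    proof
      assume sc: "scalar2 (adj_word w Z)"
      define a where "a = adj_word w Z $ 1 $ 1"
      have "a * a = 1" using det_adj_word[of Z w, OF Z(1)] sc by (simp add: det_2 scalar2_def a_def)
      hence "a = 1 \<or> a = - 1" by (simp add: square_eq_1_iff)
      moreover have "c = 2 * a" using Z(2) sc by (simp add: scalar2_def a_def)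
      ultimately show False using c False by auto
    qed
    then show ?thesis using Z by blast
  qed
  have attained: "\<exists>Y. (\<forall>i. det (Y i) = 1) \<and> adj_word w Y = A"
    if A: "det A = 1" "A $ 1 $ 1 + A $ 2 $ 2 \<noteq> - 2" for A :: "'k^2^2"
  proof (cases "scalar2 A")
    case True
    have "A $ 1 $ 1 * A $ 1 $ 1 = 1" using A(1) True by (simp add: det_2 scalar2_def)
    hence "A $ 1 $ 1 = 1 \<or> A $ 1 $ 1 = - 1" by (simp add: square_eq_1_iff)
    hence "A = mat 1" using A(2) True by (auto simp: mat2_eq_iff scalar2_def)
    then show ?thesis by (intro exI[of _ "\<lambda>i. mat 1"]) (simp add: adj_word_one)
  next
    case False
    obtain Z :: "nat \<Rightarrow> 'k^2^2" where "\<And>i. det (Z i) = 1" "\<not> scalar2 (adj_word w Z)"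
      "adj_word w Z $ 1 $ 1 + adj_word w Z $ 2 $ 2 = A $ 1 $ 1 + A $ 2 $ 2"
      using nonscalar[OF A(2)] by blast
    then show ?thesis by (rule adj_word_value_if_same_trace[OF A(1) False])
  qed
  let ?N = "{mat 1, - mat 1 :: 'k^2^2}"
  interpret N: normal ?N "SL2 :: ('k^2^2) monoid" by (rule normal_center_SL2)
  interpret h: group_hom "SL2 :: ('k^2^2) monoid" PSL2 "\<lambda>A. ?N #>\<^bsub>SL2\<^esub> A"
    unfolding PSL2_def
    by (intro group_hom.intro group_hom_axioms.intro group_SL2 N.factorgroup_is_group N.r_coset_hom_Mod)
  show ?thesis unfolding word_map_surjective_def
  proof
    fix y :: "('k^2^2) set"
    assume "y \<in> carrier PSL2"
    then obtain A :: "'k^2^2" where A: "det A = 1" and y: "y = ?N #>\<^bsub>SL2\<^esub> A"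
      by (auto simp: PSL2_def FactGroup_def RCOSETS_def)
    have "- mat 1 ** A = - A" "- mat 1 ** - A = A" by (simp_all add: mat2_eq_iff)
    hence y': "y = ?N #>\<^bsub>SL2\<^esub> (- A)" by (auto simp: y r_coset_def)
    have dA: "det (- A) = 1" using A by (simp add: det_2)
    \<comment> \<open>Both \<open>A\<close> and \<open>- A\<close> represent \<open>y\<close>; their
      traces are opposite, so at least one of them differs from -2.\<close>
    obtain Y where Y: "\<And>i. det (Y i) = 1" and Yy: "y = ?N #>\<^bsub>SL2\<^esub> adj_word w Y"
    proof (cases "A $ 1 $ 1 + A $ 2 $ 2 = - 2")
      case True
      have "(- A) $ 1 $ 1 + (- A) $ 2 $ 2 = - (A $ 1 $ 1 + A $ 2 $ 2)" by simp
      hence "(- A) $ 1 $ 1 + (- A) $ 2 $ 2 \<noteq> - 2" by (simp only: True) simp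
      then show ?thesis using attained[OF dA] that y' by metis
    next
      case False
      then show ?thesis using attained[OF A] that y by metis
    qed
    \<comment> \<open>The projection to PSL(2,K) is a homomorphism and carries values of
      \<open>w\<close> to values of \<open>w\<close>.\<close>
    have "word_map PSL2 w (\<lambda>i. ?N #>\<^bsub>SL2\<^esub> Y i) = y"
      using h.hom_signed_prod[of Y w] Y by (simp add: word_map_eq_signed_prod signed_prod_SL2 Yy)
    moreover have "?N #>\<^bsub>SL2\<^esub> Y i \<in> carrier PSL2" for i
      using Y by (intro h.hom_closed) simp
    ultimately show "\<exists>xs. (\<forall>i<n. xs i \<in> carrier PSL2) \<and> word_map PSL2 w xs = y"
      by (intro exI[of _ "\<lambda>i. ?N #>\<^bsub>SL2\<^esub> Y i"]) simp
  qed
qed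

end
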